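(* Every rooted tree of radius less than or equal to $7$ is long-repetition-free $2$-colorable.
   Context: A word $\bar w$ is a long square if $\bar w = \bar u\bar u$ for some word $\bar u$ with $|\bar u| \ge 3$. A word is long-square-free if it contains no sub-word (that is, no block of consecutive letters) that is a long square. A simple connected graph $G=(V,E)$ is long-repetition-free $k$-colorable if there exists a coloring $\chi : V \to \{1,\dots,k\}$ (any map; adjacent vertices may receive the same color) such that for every path in $G$ with successive vertices $u_1,\dots,u_n$ (a path has pairwise distinct vertices), the word $\chi(u_1)\cdots\chi(u_n)$ is long-square-free. The distance between two vertices of a connected graph is the number of edges in a shortest path between them; the eccentricity of a vertex is the maximum distance from it to any other vertex; the radius of the graph is the minimum eccentricity of its vertices. A rooted tree is a tree with one distinguished vertex, called the root (the radius does not depend on the root). *)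

theory Defs
  imports
    "Graph_Theory.Digraph_Component"
    "Graph_Theory.Vertex_Walk"
    "HOL-Library.Sublist"
    "HOL-Library.Extended_Nat"
begin

definition long_square :: "'c list \<Rightarrow> bool" where
  "long_square w \<longleftrightarrow> (\<exists>u. w = u @ u \<and> length u \<ge> 3)"

definition long_square_free :: "'c list \<Rightarrow> bool" where
  "long_square_free w \<longleftrightarrow> \<not> (\<exists>s. sublist s w \<and> long_square s)"

text \<open>
  A simple graph, possibly infinite, is given by its vertex set and its symmetric, irreflexive
  adjacency relation; this is what \<^locale>\<open>pair_bidirected_digraph\<close> provides.

  The library predicate \<^const>\<open>tree\<close> is unsuitable for such graphs: every edge, traversed back
  and forth, counts as a \<^const>\<open>pre_digraph.cycle\<close> of length 2. The cycles of an undirected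
  simple graph are exactly those of length at least 3. The library notion of connectedness
  includes that there is at least one vertex.
\<close>

definition simple_connected_graph :: "'a pair_pre_digraph \<Rightarrow> bool" where
  "simple_connected_graph G \<longleftrightarrow> pair_bidirected_digraph G \<and> connected (with_proj G)"

definition undirected_tree :: "'a pair_pre_digraph \<Rightarrow> bool" where
  "undirected_tree G \<longleftrightarrow>
     simple_connected_graph G \<and> \<not> (\<exists>p. pre_digraph.cycle (with_proj G) p \<and> length p \<ge> 3)"

definition rooted_tree :: "'a pair_pre_digraph \<Rightarrow> 'a \<Rightarrow> bool" where
  "rooted_tree G r \<longleftrightarrow> undirected_tree G \<and> r \<in> pverts G"

definition graph_dist :: "'a pair_pre_digraph \<Rightarrow> 'a \<Rightarrow> 'a \<Rightarrow> enat" where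
  "graph_dist G u v =
     (INF p \<in> {p. vpath p (with_proj G) \<and> hd p = u \<and> last p = v}. enat (vwalk_length p))"

text \<open>
  Suprema are taken in \<^typ>\<open>enat\<close>: a vertex of an infinite graph with unbounded distances has
  eccentricity \<open>\<infinity>\<close>, and the only vertex of a one-vertex graph has eccentricity 0.
\<close>

definition eccentricity :: "'a pair_pre_digraph \<Rightarrow> 'a \<Rightarrow> enat" where
  "eccentricity G u = (SUP v \<in> pverts G - {u}. graph_dist G u v)"

definition graph_radius :: "'a pair_pre_digraph \<Rightarrow> enat" where
  "graph_radius G = (INF u \<in> pverts G. eccentricity G u)"

definition long_repetition_free_colorable :: "'a pair_pre_digraph \<Rightarrow> nat \<Rightarrow> bool" where
  "long_repetition_free_colorable G k \<longleftrightarrow>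
     (\<exists>\<chi> :: 'a \<Rightarrow> nat. (\<forall>v \<in> pverts G. \<chi> v \<in> {1..k}) \<and>
        (\<forall>p. vpath p (with_proj G) \<longrightarrow> long_square_free (map \<chi> p)))"

end

theory Submission
  imports Defs
begin

text \<open>
  Root the tree at a vertex of minimal eccentricity, so that all depths are at most 7, and give all
  vertices of depth \<open>i\<close> the \<open>i\<close>-th letter of \<open>w = 11121222\<close>. A vertex of a tree has only one
  neighbour of smaller depth, so the depths along any path first decrease and then increase, by one
  at each step. The colours along a path therefore form a block of a palindrome \<open>rev v @ tl v\<close> with
  \<open>v\<close> a suffix of \<open>w\<close>, and inspection shows these eight palindromes to be long-square-free.
\<close>

section \<open>Long squares\<close>

lemma long_square_free_Nil: "long_square_free []"
  by (auto simp: long_square_free_def long_square_def)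

lemma long_square_free_Cons:
  "long_square_free (x # w) \<longleftrightarrow>
     (\<forall>u \<in> set (prefixes (x # w)). 3 \<le> length u \<longrightarrow> \<not> prefix (u @ u) (x # w)) \<and> long_square_free w"
proof -
  have "(\<exists>s. prefix s v \<and> long_square s) \<longleftrightarrow>
      (\<exists>u \<in> set (prefixes v). 3 \<le> length u \<and> prefix (u @ u) v)" for v :: "'a list"
    by (fastforce simp: long_square_def dest: append_prefixD)
  from this[of "x # w"] show ?thesis
    unfolding long_square_free_def sublist_Cons_right by meson
qed

lemma long_square_free_sublist:
  assumes "long_square_free w" and "sublist v w"
  shows "long_square_free v"
  using assms by (auto simp: long_square_free_def dest: sublist_order.order.trans)

section \<open>Walks on the natural numbers without peaks\<close>

definition peakless_walk :: "nat list \<Rightarrow> bool" where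
  "peakless_walk ns \<longleftrightarrow>
     successively (\<lambda>a b. b = Suc a \<or> a = Suc b) ns \<and> (\<forall>a. \<not> sublist [a, Suc a, a] ns)"

lemma peakless_walk_ConsD:
  assumes "peakless_walk (n # ns)"
  shows "peakless_walk ns"
  using assms by (auto simp: peakless_walk_def successively_Cons sublist_Cons_right)

lemma peakless_walk_ascending:
  assumes "peakless_walk (n # Suc n # ns)"
  shows "\<exists>k > n. n # Suc n # ns = [n..<k]"
  using assms
proof (induction ns arbitrary: n)
  case Nil
  have "[n, Suc n] = [n..<Suc (Suc n)]" by simp
  then show ?case by (metis lessI less_SucI)
next
  case (Cons a ns)
  have "a \<noteq> n"
  proof
    assume "a = n"
    then have "sublist [n, Suc n, n] (n # Suc n # a # ns)"
      by (simp add: sublist_Cons_right)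
    with Cons.prems show False by (simp add: peakless_walk_def)
  qed
  then have "a = Suc (Suc n)"
    using Cons.prems by (auto simp: peakless_walk_def)
  with Cons obtain k where "Suc n < k" and "Suc n # a # ns = [Suc n..<k]"
    using peakless_walk_ConsD by blast
  then have "n # Suc n # a # ns = [n..<k]"
    by (simp add: upt_conv_Cons)
  with \<open>Suc n < k\<close> show ?case by (metis Suc_lessD)
qed

lemma peakless_walk_descending_ascending:
  assumes "peakless_walk ns" and "ns \<noteq> []"
  shows "\<exists>m i j. m < i \<and> m < j \<and> ns = rev [m..<i] @ [Suc m..<j]"
  using assms
proof (induction ns rule: induct_list012)
  case (2 n)
  have "[n] = rev [n..<Suc n] @ [Suc n..<Suc n]" by simp
  then show ?case by (metis lessI)
next
  case (3 n n' ns)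
  consider (up) "n' = Suc n" | (down) "n = Suc n'"
    using "3.prems"(1) by (auto simp: peakless_walk_def)
  then show ?case
  proof cases
    case up
    with "3.prems"(1) obtain k where "n < k" and "n # n' # ns = [n..<k]"
      using peakless_walk_ascending by blast
    then have "n # n' # ns = rev [n..<Suc n] @ [Suc n..<k]"
      by (simp add: upt_conv_Cons)
    with \<open>n < k\<close> show ?thesis by (metis lessI)
  next
    case down
    obtain m i j where "m < i" and "m < j" and tail: "n' # ns = rev [m..<i] @ [Suc m..<j]"
      using "3.IH"(2) "3.prems"(1) peakless_walk_ConsD by blast
    then have "i = n"
      using down by (cases i) auto
    with down tail \<open>m < i\<close> have "n # n' # ns = rev [m..<Suc n] @ [Suc m..<j]"
      by simp
    with \<open>i = n\<close> \<open>m < i\<close> \<open>m < j\<close> show ?thesis by (metis less_SucI)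
  qed
qed simp

lemma sublist_rev_append:
  assumes "prefix xs xs'" and "prefix ys ys'"
  shows "sublist (rev xs @ ys) (rev xs' @ ys')"
proof -
  obtain zs zs' where "xs' = xs @ zs" and "ys' = ys @ zs'"
    using assms by (auto simp: prefix_def)
  then have "rev xs' @ ys' = rev zs @ (rev xs @ ys) @ zs'"
    by simp
  then show ?thesis
    by (metis sublist_appendI)
qed

lemma prefix_upt:
  assumes "j \<le> k"
  shows "prefix [i..<j] [i..<k]"
proof -
  have "[i..<j] = take (j - i) [i..<k]"
    using assms by (cases "i \<le> j") auto
  then show ?thesis by (metis take_is_prefix)
qed

lemma peakless_walk_sublist_palindrome:
  assumes "peakless_walk ns" and "set ns \<subseteq> {..<n}"
  shows "\<exists>m. sublist ns (rev [m..<n] @ tl [m..<n])"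
proof (cases "ns = []")
  case False
  with assms(1) obtain m i j
    where "m < i" and "m < j" and ns: "ns = rev [m..<i] @ [Suc m..<j]"
    using peakless_walk_descending_ascending by metis
  have "i - 1 \<in> set ns" and "j - 1 \<in> set ns"
    using \<open>m < i\<close> \<open>m < j\<close> unfolding ns by auto
  with assms(2) \<open>m < i\<close> \<open>m < j\<close> have "i \<le> n" and "j \<le> n"
    by auto
  then have "sublist ns (rev [m..<n] @ [Suc m..<n])"
    unfolding ns by (intro sublist_rev_append prefix_upt)
  then show ?thesis by auto
qed simp

lemma map_nth_upt_length: "map ((!) w) [m..<length w] = drop m w"
  by (metis drop_map drop_upt map_nth plus_nat.add_0)

lemma long_square_free_map_nth_peakless_walk:
  assumes palindromes: "\<And>v. suffix v w \<Longrightarrow> long_square_free (rev v @ tl v)"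
    and "peakless_walk ns" and "set ns \<subseteq> {..<length w}"
  shows "long_square_free (map ((!) w) ns)"
proof -
  obtain m where "sublist ns (rev [m..<length w] @ tl [m..<length w])"
    using peakless_walk_sublist_palindrome[OF assms(2,3)] by blast
  then have "sublist (map ((!) w) ns) (map ((!) w) (rev [m..<length w] @ tl [m..<length w]))"
    by (rule map_mono_sublist)
  also have "map ((!) w) (rev [m..<length w] @ tl [m..<length w]) = rev (drop m w) @ tl (drop m w)"
    by (simp only: map_append map_tl rev_map[symmetric] map_nth_upt_length)
  finally show ?thesis
    using palindromes[OF suffix_drop] by (rule long_square_free_sublist[rotated])
qed

section \<open>Paths and cycles\<close>

lemma vwalk_successively:
  assumes "vwalk p G"
  shows "successively (\<lambda>u v. (u, v) \<in> arcs_ends G) p"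
  using assms by (induction p rule: vwalk_induct) auto

lemma vpathI_append_l:
  assumes "p \<noteq> []" and "vpath (p @ q) G"
  shows "vpath p G"
  using assms vwalkI_append_l by (auto simp: vpath_def)

lemma vpathI_append_r:
  assumes "q \<noteq> []" and "vpath (p @ q) G"
  shows "vpath q G"
  using assms vwalkI_append_r by (auto simp: vpath_def)

lemma vpath_snocI:
  assumes "vpath p G" and "v \<in> verts G" and "(last p, v) \<in> arcs_ends G" and "v \<notin> set p"
  shows "vpath (p @ [v]) G"
  using assms by (auto simp: vpath_def vwalk_def set_vwalk_arcs_snoc)

lemma pawalk_verts_vwalk_arcs:
  assumes "p \<noteq> []"
  shows "pawalk_verts (hd p) (vwalk_arcs p) = p"
  using assms by (induction p rule: vwalk_arcs.induct) auto

lemma pcas_vwalk_arcs: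
  assumes "p \<noteq> []"
  shows "pcas (hd p) (vwalk_arcs p) (last p)"
  using assms by (induction p rule: vwalk_arcs.induct) auto

lemma (in pair_pre_digraph) cycle_vwalk_arcs:
  assumes "vwalk p G" and "hd p = last p" and "distinct (tl p)" and "2 \<le> length p"
  shows "cycle (vwalk_arcs p)"
proof -
  have "p \<noteq> []" and "vwalk_arcs p \<noteq> []"
    using assms(4) by (auto simp: Suc_le_length_iff numeral_2_eq_2)
  moreover from \<open>p \<noteq> []\<close> have "awalk (hd p) (vwalk_arcs p) (hd p)"
    using assms(1) pcas_vwalk_arcs[of p] unfolding awalk_def assms(2)[symmetric]
    by (auto simp: vwalk_def)
  ultimately show ?thesis
    unfolding cycle_def using assms(3) pawalk_verts_vwalk_arcs[of p] by auto
qed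

lemma prefix_same_last_distinct:
  assumes "prefix xs ys" and "xs \<noteq> []" and "last xs = last ys" and "distinct ys"
  shows "xs = ys"
proof (rule ccontr)
  assume "xs \<noteq> ys"
  then obtain zs where "ys = xs @ zs" and "zs \<noteq> []"
    using \<open>prefix xs ys\<close> by (auto simp: prefix_def)
  with assms have "last xs \<in> set xs \<inter> set zs"
    by (metis IntI last_appendR last_in_set)
  with \<open>distinct ys\<close> \<open>ys = xs @ zs\<close> show False by auto
qed

context pair_sym_digraph
begin

lemma internally_disjoint_vpaths_cycle:
  assumes p: "vpath (u # p @ [v]) G" and q: "vpath (u # q @ [v]) G"
    and "set p \<inter> set q = {}" and "p \<noteq> q"
  shows "\<exists>c. cycle c \<and> 3 \<le> length c"
proof -
  let ?w = "(u # p @ [v]) \<oplus> rev (u # q @ [v])"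
  have w: "?w = u # p @ v # rev q @ [u]"
    by (simp add: vwalk_join_def)
  have "vwalk (rev (u # q @ [v])) G"
    using q pair_sym_arcs by (blast intro: vwalk_rev_ex)
  then have "vwalk ?w G"
    using p by (intro vwalk_joinI_vwalk') auto
  moreover have "distinct (tl ?w)"
    using p q assms(3) unfolding w vpath_def by auto
  ultimately have "cycle (vwalk_arcs ?w)"
    unfolding w by (intro cycle_vwalk_arcs) auto
  moreover have "p \<noteq> [] \<or> q \<noteq> []"
    using \<open>p \<noteq> q\<close> by auto
  then have "3 \<le> vwalk_length ?w"
    unfolding w vwalk_length_simp by (auto simp: neq_Nil_conv)
  ultimately show ?thesis
    unfolding vwalk_length_def by blast
qed

lemma diverging_vpaths_cycle:
  assumes p: "vpath (u # a # p) G" and q: "vpath (u # b # q) G"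
    and "a \<noteq> b" and "last (a # p) = last (b # q)"
  shows "\<exists>c. cycle c \<and> 3 \<le> length c"
proof -
  have "\<exists>x \<in> set (a # p). x \<in> set (b # q)"
    using assms(4) by (metis last_in_set list.distinct(1))
  then obtain p1 x p2 where p_split: "a # p = p1 @ x # p2" and "x \<in> set (b # q)"
    and "\<forall>y \<in> set p1. y \<notin> set (b # q)"
    by (elim split_list_first_propE) blast
  moreover from \<open>x \<in> set (b # q)\<close> obtain q1 q2 where q_split: "b # q = q1 @ x # q2"
    by (meson split_list)
  ultimately have "set p1 \<inter> set q1 = {}"
    by auto
  moreover have "p1 \<noteq> q1"
    using \<open>a \<noteq> b\<close> p_split q_split by (auto simp: Cons_eq_append_conv)
  moreover have "vpath (u # p1 @ [x]) G" and "vpath (u # q1 @ [x]) G"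
    using p q vpathI_append_l[of "u # p1 @ [x]" p2] vpathI_append_l[of "u # q1 @ [x]" q2]
    unfolding p_split q_split by simp_all
  ultimately show ?thesis
    by (intro internally_disjoint_vpaths_cycle)
qed

lemma distinct_vpaths_cycle:
  assumes p: "vpath p G" and q: "vpath q G"
    and "hd p = hd q" and "last p = last q" and "p \<noteq> q"
  shows "\<exists>c. cycle c \<and> 3 \<le> length c"
proof -
  have "p \<noteq> []" and "distinct p" and "q \<noteq> []" and "distinct q"
    using p q by auto
  then have "\<not> prefix p q" and "\<not> prefix q p"
    using prefix_same_last_distinct \<open>last p = last q\<close> \<open>p \<noteq> q\<close> by metis+
  then have "p \<parallel> q"
    by (rule parallelI)
  then obtain cs a as b bs where "a \<noteq> b" and p_eq: "p = cs @ a # as" and q_eq: "q = cs @ b # bs"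
    using parallel_decomp by blast
  then obtain ds u where "cs = ds @ [u]"
    using \<open>hd p = hd q\<close> by (cases cs rule: rev_cases) auto
  then have "vpath (u # a # as) G" and "vpath (u # b # bs) G"
    using p q vpathI_append_r[of "u # a # as" ds] vpathI_append_r[of "u # b # bs" ds]
    unfolding p_eq q_eq by simp_all
  moreover have "last (a # as) = last (b # bs)"
    using \<open>last p = last q\<close> unfolding p_eq q_eq by simp
  ultimately show ?thesis
    using \<open>a \<noteq> b\<close> by (intro diverging_vpaths_cycle)
qed

end

section \<open>Depth in a rooted tree\<close>

locale tree_with_root =
  fixes G :: "'a pair_pre_digraph" and r :: 'a
  assumes rooted_tree: "rooted_tree G r"

sublocale tree_with_root \<subseteq> pair_bidirected_digraph G
  using rooted_tree by (simp add: rooted_tree_def undirected_tree_def simple_connected_graph_def)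

context tree_with_root
begin

lemma root_in_verts: "r \<in> pverts G"
  using rooted_tree by (simp add: rooted_tree_def)

lemma vpath_unique:
  assumes "vpath p G" and "vpath q G" and "hd p = hd q" and "last p = last q"
  shows "p = q"
  using assms distinct_vpaths_cycle rooted_tree
  unfolding rooted_tree_def undirected_tree_def by blast

lemma ex_vpath_from_root:
  assumes "v \<in> pverts G"
  shows "\<exists>p. vpath p G \<and> hd p = r \<and> last p = v"
proof -
  have "strongly_connected G"
    using rooted_tree pair_sym_arcs
    by (intro symmetric_connected_imp_strongly_connected)
      (simp_all add: rooted_tree_def undirected_tree_def simple_connected_graph_def)
  then have "r \<rightarrow>\<^sup>*\<^bsub>G\<^esub> v"
    using root_in_verts assms by auto
  then show ?thesis
    by (simp add: reachable_vpath_conv)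
qed

definition root_path :: "'a \<Rightarrow> 'a list" where
  "root_path v = (THE p. vpath p G \<and> hd p = r \<and> last p = v)"

lemma root_path_eqI:
  assumes "vpath p G" and "hd p = r" and "last p = v"
  shows "root_path v = p"
  unfolding root_path_def using assms vpath_unique by (intro the_equality) auto

lemma root_path:
  assumes "v \<in> pverts G"
  shows vpath_root_path: "vpath (root_path v) G"
    and hd_root_path: "hd (root_path v) = r"
    and last_root_path: "last (root_path v) = v"
  using ex_vpath_from_root[OF assms] root_path_eqI by auto

lemma root_path_neq_Nil:
  assumes "v \<in> pverts G"
  shows "root_path v \<noteq> []"
  using vpath_root_path[OF assms] by auto

lemma root_path_snoc:
  assumes "(u, v) \<in> parcs G" and "v \<notin> set (root_path u)"
  shows "root_path v = root_path u @ [v]"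
proof (rule root_path_eqI)
  have "u \<in> pverts G" and "v \<in> pverts G"
    using assms(1) by (auto dest: wellformed')
  then show "vpath (root_path u @ [v]) G"
    using assms by (intro vpath_snocI) (auto simp: vpath_root_path last_root_path)
  show "hd (root_path u @ [v]) = r"
    using \<open>u \<in> pverts G\<close> by (simp add: hd_root_path root_path_neq_Nil)
qed simp

lemma root_path_antisym:
  assumes "u \<in> pverts G" and "v \<in> set (root_path u)" and "u \<in> set (root_path v)"
  shows "u = v"
proof (rule ccontr)
  assume "u \<noteq> v"
  obtain p q where u: "root_path u = p @ v # q"
    using assms(2) by (meson split_list)
  have "root_path v = p @ [v]"
  proof (rule root_path_eqI)
    show "vpath (p @ [v]) G"
      using vpath_root_path[OF assms(1)] vpathI_append_l[of "p @ [v]" q] unfolding u by simp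
    show "hd (p @ [v]) = r"
      using hd_root_path[OF assms(1)] unfolding u by (cases p) auto
  qed simp
  with assms(3) \<open>u \<noteq> v\<close> have "u \<in> set p"
    by simp
  moreover have "u \<in> set q"
    using last_root_path[OF assms(1)] \<open>u \<noteq> v\<close> unfolding u by (auto split: if_splits)
  ultimately show False
    using vpath_root_path[OF assms(1)] unfolding u vpath_def by auto
qed

lemma root_path_adjacent:
  assumes "(u, v) \<in> parcs G"
  shows "root_path v = root_path u @ [v] \<or> root_path u = root_path v @ [u]"
proof (cases "v \<in> set (root_path u)")
  case True
  then have "u \<notin> set (root_path v)"
    using assms root_path_antisym by (metis no_loops' wellformed'(1))
  with assms show ?thesis
    by (blast intro: root_path_snoc arcs_symmetric)
next
  case False
  with assms show ?thesis by (blast intro: root_path_snoc)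
qed

definition depth :: "'a \<Rightarrow> nat" where
  "depth v = vwalk_length (root_path v)"

lemma length_root_path:
  assumes "v \<in> pverts G"
  shows "length (root_path v) = Suc (depth v)"
  using root_path_neq_Nil[OF assms] by (simp add: depth_def)

lemma graph_dist_root:
  assumes "v \<in> pverts G"
  shows "graph_dist G r v = enat (depth v)"
proof -
  have "{p. vpath p G \<and> hd p = r \<and> last p = v} = {root_path v}"
    using root_path[OF assms] by (auto dest: root_path_eqI)
  then show ?thesis
    unfolding graph_dist_def depth_def by simp
qed

lemma depth_le_eccentricity:
  assumes "v \<in> pverts G"
  shows "enat (depth v) \<le> eccentricity G r"
proof (cases "v = r")
  case True
  have "root_path r = [r]"
    using root_in_verts by (intro root_path_eqI vpath_self) auto
  with True show ?thesis
    by (simp add: depth_def zero_enat_def[symmetric])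
next
  case False
  with assms show ?thesis
    unfolding eccentricity_def graph_dist_root[OF assms, symmetric] by (intro SUP_upper) simp
qed

lemma depth_adjacent:
  assumes "(u, v) \<in> parcs G"
  shows "depth v = Suc (depth u) \<or> depth u = Suc (depth v)"
  using root_path_adjacent[OF assms] length_root_path wellformed'[OF assms]
  by (metis Suc_inject length_append_singleton)

lemma root_path_child:
  assumes "(u, v) \<in> parcs G" and "depth v = Suc (depth u)"
  shows "root_path v = root_path u @ [v]"
  using root_path_adjacent[OF assms(1)] assms(2) by (auto simp: depth_def)

lemma parent_unique:
  assumes "(u, v) \<in> parcs G" and "(w, v) \<in> parcs G"
    and "depth v = Suc (depth u)" and "depth v = Suc (depth w)"
  shows "u = w"
proof -
  have "root_path u = root_path w"
    using root_path_child[OF assms(1,3)] root_path_child[OF assms(2,4)] by simp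
  then show ?thesis
    using assms(1,2) by (metis last_root_path wellformed'(1))
qed

lemma peakless_walk_depths:
  assumes "vpath p G"
  shows "peakless_walk (map depth p)"
  unfolding peakless_walk_def
proof (intro conjI allI notI)
  have arcs: "successively (\<lambda>u v. (u, v) \<in> parcs G) p"
    using assms vwalk_successively[of p G] by auto
  then show "successively (\<lambda>a b. b = Suc a \<or> a = Suc b) (map depth p)"
    unfolding successively_map by (rule successively_mono) (use depth_adjacent in blast)
  fix k
  assume "sublist [k, Suc k, k] (map depth p)"
  then obtain s where "sublist s p" and "map depth s = [k, Suc k, k]"
    by (metis sublist_map_rightE)
  then obtain q u v w q' where p: "p = q @ [u, v, w] @ q'"
    and "depth u = k" and "depth v = Suc k" and "depth w = k"
    by (auto simp: sublist_def map_eq_Cons_conv)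
  moreover have "(u, v) \<in> parcs G" and "(w, v) \<in> parcs G"
    using arcs arcs_symmetric unfolding p by (auto simp: successively_append_iff)
  ultimately have "u = w"
    by (intro parent_unique) auto
  with assms show False
    unfolding p vpath_def by simp
qed

lemma long_square_free_depth_coloring:
  assumes "\<And>v. suffix v w \<Longrightarrow> long_square_free (rev v @ tl v)"
    and depths: "\<And>v. v \<in> pverts G \<Longrightarrow> depth v < length w"
    and p: "vpath p G"
  shows "long_square_free (map (\<lambda>v. w ! depth v) p)"
proof -
  have "set p \<subseteq> pverts G"
    using p by (auto simp: vpath_def vwalk_def)
  with depths have "set (map depth p) \<subseteq> {..<length w}"
    by auto
  then have "long_square_free (map ((!) w) (map depth p))"
    using assms(1) peakless_walk_depths[OF p] by (intro long_square_free_map_nth_peakless_walk)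
  then show ?thesis by (simp add: comp_def)
qed

end

section \<open>Colouring by depth\<close>

lemma undirected_tree_depth_colorable:
  assumes tree: "undirected_tree G" and radius: "graph_radius G < enat (length w)"
    and colors: "set w \<subseteq> {1..k}"
    and palindromes: "\<And>v. suffix v w \<Longrightarrow> long_square_free (rev v @ tl v)"
  shows "long_repetition_free_colorable G k"
proof -
  obtain r where "r \<in> pverts G" and ecc: "eccentricity G r < enat (length w)"
    using radius unfolding graph_radius_def INF_less_iff by blast
  with tree interpret tree_with_root G r
    by unfold_locales (simp add: rooted_tree_def)
  have depths: "depth v < length w" if "v \<in> pverts G" for v
    using le_less_trans[OF depth_le_eccentricity[OF that] ecc] by simp
  then have "\<forall>v \<in> pverts G. w ! depth v \<in> {1..k}"
    using colors nth_mem by blast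
  then show ?thesis
    unfolding long_repetition_free_colorable_def
    using long_square_free_depth_coloring[OF palindromes] depths
    by (intro exI[of _ "\<lambda>v. w ! depth v"]) simp
qed

theorem proposition2p2:
  fixes G :: "'a pair_pre_digraph" and r :: 'a
  assumes "rooted_tree G r"
    and "graph_radius G \<le> 7"
  shows "long_repetition_free_colorable G 2"
proof (rule undirected_tree_depth_colorable)
  let ?w = "[1, 1, 1, 2, 1, 2, 2, 2] :: nat list"
  show "undirected_tree G"
    using assms(1) by (simp add: rooted_tree_def)
  have "(7::enat) < enat (length ?w)"
    by (simp add: numeral_eq_enat)
  with assms(2) show "graph_radius G < enat (length ?w)"
    by (rule le_less_trans)
  show "set ?w \<subseteq> {1..2}"
    by simp
  have "\<forall>v \<in> set (suffixes ?w). long_square_free (rev v @ tl v)"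
    by (simp add: long_square_free_Nil long_square_free_Cons)
  then show "long_square_free (rev v @ tl v)" if "suffix v ?w" for v
    using that unfolding in_set_suffixes[symmetric] by blast
qed

end
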